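(* Let $n\in\mathbb{N}$, let $K\subseteq\mathbb{R}^n$ be closed, and let $A:\mathbb{R}[x_1,\dots,x_n]\to\mathbb{R}[x_1,\dots,x_n]$ be a linear operator in $\mathfrak{g}$, with a family $\mathcal{V}=\{V_i\}_{i\in\mathbb{N}_0}$ of finite dimensional linear subspaces $V_i\subseteq\mathbb{R}[x_1,\dots,x_n]$ such that $AV_i\subseteq V_i$ for all $i\in\mathbb{N}_0$ and $\bigcup_{i\in\mathbb{N}_0}V_i=\mathbb{R}[x_1,\dots,x_n]$. Then the following are equivalent: (i) $(e^{tA})_{t\geq 0}$ is a $K$-positivity preserving semi-group, i.e. $e^{tA}\mathrm{Pos}(K)\subseteq\mathrm{Pos}(K)$ for all $t\geq 0$. (ii) For each $i\in\mathbb{N}_0$ there exists an $\varepsilon_i>0$ such that \[(\mathbf{1}-\lambda A)^{-1}(\mathrm{Pos}(K)\cap V_i)\subseteq\mathrm{Pos}(K)\cap V_i\] for all $\lambda\in[0,\varepsilon_i)$.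
   Context: $\mathrm{Pos}(K)=\{f\in\mathbb{R}[x_1,\dots,x_n] : f(x)\geq 0\text{ for all }x\in K\}$. $\mathfrak{g}$ is the set of linear operators $A$ on $\mathbb{R}[x_1,\dots,x_n]$ for which $e^{tA}p=\sum_{k\geq0}\frac{t^k}{k!}A^kp$ converges (with degrees of the partial sums bounded, coefficientwise) to a polynomial for every polynomial $p$ and all $t\in[0,\varepsilon)$ for some fixed $\varepsilon>0$; equivalently, those $A$ for which a family $\mathcal{V}$ as in the claim exists. For such $A$, $e^{tA}$ is defined on all of $\mathbb{R}[x_1,\dots,x_n]$ for all $t\in\mathbb{R}$, and $e^{tA}|_{V_i}$ is the matrix exponential of $tA|_{V_i}$. $\mathbf{1}$ is the identity. In (ii), $(\mathbf{1}-\lambda A)^{-1}$ denotes the inverse of the operator $\mathbf{1}-\lambda A|_{V_i}$ on the finite dimensional space $V_i$; (ii) includes that this inverse exists for all $\lambda\in[0,\varepsilon_i)$. *)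

theory Defs
  imports "HOL-Analysis.Analysis" "HOL-Library.Poly_Mapping"
begin

instantiation poly_mapping :: (type, real_vector) real_vector
begin

lift_definition scaleR_poly_mapping :: "real \<Rightarrow> ('a \<Rightarrow>\<^sub>0 'b) \<Rightarrow> 'a \<Rightarrow>\<^sub>0 'b"
  is "\<lambda>c f k. c *\<^sub>R f k"
  by (erule rev_finite_subset) auto

instance
  by standard (transfer; simp add: fun_eq_iff scaleR_add_right scaleR_add_left)+

end

(* Real polynomials in CARD('n) variables. The outer finitely supported map sends an exponent
   vector to its coefficient. *)
type_synonym 'n rpoly = "('n \<Rightarrow>\<^sub>0 nat) \<Rightarrow>\<^sub>0 real"

definition peval :: "('n::finite) rpoly \<Rightarrow> real ^ 'n \<Rightarrow> real" where
  "peval p x = (\<Sum>m\<in>Poly_Mapping.keys p.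
     Poly_Mapping.lookup p m * (\<Prod>i\<in>UNIV. (x $ i) ^ Poly_Mapping.lookup m i))"

definition total_degree :: "('n::finite) rpoly \<Rightarrow> nat" where
  "total_degree p =
     Max (insert 0 ((\<lambda>m. \<Sum>i\<in>UNIV. Poly_Mapping.lookup m i) ` Poly_Mapping.keys p))"

definition Pos :: "(real ^ 'n) set \<Rightarrow> ('n::finite) rpoly set" where
  "Pos K = {f. \<forall>x\<in>K. peval f x \<ge> 0}"

(* Convergence of a sequence in the finest locally convex topology: coefficientwise, with
   bounded degrees. *)
definition poly_converges :: "(nat \<Rightarrow> ('n::finite) rpoly) \<Rightarrow> 'n rpoly \<Rightarrow> bool" where
  "poly_converges q p \<longleftrightarrow>
     (\<exists>d. \<forall>N. total_degree (q N) \<le> d) \<and>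
     (\<forall>m. (\<lambda>N. Poly_Mapping.lookup (q N) m) \<longlonglongrightarrow> Poly_Mapping.lookup p m)"

lemma poly_converges_unique:
  assumes "poly_converges q p" "poly_converges q p'"
  shows "p = p'"
  using assms unfolding poly_converges_def
  by (intro poly_mapping_eqI) (blast intro: LIMSEQ_unique)

definition exp_partial ::
    "real \<Rightarrow> (('n::finite) rpoly \<Rightarrow> 'n rpoly) \<Rightarrow> 'n rpoly \<Rightarrow> nat \<Rightarrow> 'n rpoly" where
  "exp_partial t A p N = (\<Sum>k<N. (t ^ k / fact k) *\<^sub>R (A ^^ k) p)"

(* e^{tA} p; unspecified when the exponential series does not converge to a polynomial. *)
definition op_exp :: "real \<Rightarrow> (('n::finite) rpoly \<Rightarrow> 'n rpoly) \<Rightarrow> 'n rpoly \<Rightarrow> 'n rpoly" where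
  "op_exp t A p = (THE q. poly_converges (exp_partial t A p) q)"

(* The threshold e does not depend on the polynomial p. *)
definition lie_g :: "(('n::finite) rpoly \<Rightarrow> 'n rpoly) set" where
  "lie_g = {A. linear A \<and>
     (\<exists>e>0. \<forall>t\<in>{0..<e}. \<forall>p. \<exists>q. poly_converges (exp_partial t A p) q)}"

definition fin_dim_subspace :: "'a::real_vector set \<Rightarrow> bool" where
  "fin_dim_subspace V \<longleftrightarrow> subspace V \<and> (\<exists>B. finite B \<and> span B = V)"

end

theory Submission imports Defs begin

(* On a finite dimensional invariant space write y(t) = e^{tA} p. For (i) ==> (ii), if
   q - l A q = p then s |-> e^{-s} e^{slA} q has derivative -e^{-s} e^{slA} p, so at every point
   of K it decreases; for small l it tends to 0, and hence q is nonnegative on K. For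
   (ii) ==> (i), iterating the resolvent with step t/k is the implicit Euler scheme for
   y' = A y, which converges to y(t) as k tends to infinity. *)

text \<open>This is the local defect of one backward Euler step. The first mean value theorem gives
  a slope at some \<open>x\<close>, the second compares it with the slope at \<open>s + h\<close>;
  both factors \<open>h\<close> and \<open>s + h - x\<close> are at most \<open>h\<close>. Only the
  order \<open>h^2\<close> matters later, so the sharp factor 1/2 is not pursued.\<close>

lemma taylor_backward:
  fixes f f' f'' :: "real \<Rightarrow> real"
  assumes "\<And>x. (f has_real_derivative f' x) (at x)" "\<And>x. (f' has_real_derivative f'' x) (at x)"
    and "\<And>x. s \<le> x \<Longrightarrow> x \<le> s + h \<Longrightarrow> \<bar>f'' x\<bar> \<le> c" "0 \<le> h"
  shows "\<bar>f (s + h) - h * f' (s + h) - f s\<bar> \<le> c * h\<^sup>2"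
proof (cases "h = 0")
  case False
  then have h: "0 < h" using assms(4) by simp
  obtain x where x: "s < x" "x < s + h" "f (s + h) - f s = h * f' x"
    using MVT2[of s "s + h" f f'] assms(1) h by auto
  obtain y where y: "x < y" "y < s + h" "f' (s + h) - f' x = (s + h - x) * f'' y"
    using MVT2[of x "s + h" f' f''] assms(2) x by auto
  have "f (s + h) - h * f' (s + h) - f s = - (h * (f' (s + h) - f' x))"
    using x(3) by (simp add: algebra_simps)
  then have "\<bar>f (s + h) - h * f' (s + h) - f s\<bar> = h * ((s + h - x) * \<bar>f'' y\<bar>)"
    using h x y by (simp add: abs_mult)
  also have "\<dots> \<le> h * (h * c)"
    using h x y assms(3)[of y] by (intro mult_left_mono mult_mono) auto
  finally show ?thesis
    by (simp add: power2_eq_square mult.commute mult.left_commute)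
qed simp

section \<open>Coordinates and the l1 norm on the span of a finite independent set\<close>

locale finite_basis =
  fixes B :: "'a::real_vector set"
  assumes finite_B: "finite B"
    and independent_B: "independent B"
begin

(* Extending coordinates linearly to the whole space makes the norm of the span a
   seminorm that is defined everywhere. *)
definition coord :: "'a \<Rightarrow> 'a \<Rightarrow> real" where
  "coord b = construct B (\<lambda>c. if c = b then 1 else 0)"

definition cnorm :: "'a \<Rightarrow> real" where
  "cnorm v = (\<Sum>b\<in>B. \<bar>coord b v\<bar>)"

lemma linear_coord: "linear (coord b)"
  unfolding coord_def by (rule linear_construct[OF independent_B])

lemma coord_basis: "c \<in> B \<Longrightarrow> coord b c = (if c = b then 1 else 0)"
  unfolding coord_def by (rule construct_basis[OF independent_B])

lemma coord_expansion:
  assumes "v \<in> span B"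
  shows "v = (\<Sum>b\<in>B. coord b v *\<^sub>R b)"
  using assms
proof (induction rule: span_induct_alt)
  case base
  show ?case by (simp add: linear_0[OF linear_coord])
next
  case (step c x y)
  have "(\<Sum>b\<in>B. coord b x *\<^sub>R b) = (\<Sum>b\<in>B. if b = x then x else 0)"
    using step.hyps by (intro sum.cong) (auto simp: coord_basis)
  also have "\<dots> = x"
    using step.hyps finite_B by simp
  finally have x: "(\<Sum>b\<in>B. coord b x *\<^sub>R b) = x" .
  have "(\<Sum>b\<in>B. coord b (c *\<^sub>R x + y) *\<^sub>R b)
      = c *\<^sub>R (\<Sum>b\<in>B. coord b x *\<^sub>R b) + (\<Sum>b\<in>B. coord b y *\<^sub>R b)"
    by (simp add: linear_add[OF linear_coord] linear_scale[OF linear_coord]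
        scaleR_left_distrib sum.distrib scaleR_sum_right)
  then show ?case using x step.IH by simp
qed

lemma span_eqI:
  assumes "v \<in> span B" "w \<in> span B" "\<And>b. b \<in> B \<Longrightarrow> coord b v = coord b w"
  shows "v = w"
  by (metis (no_types, lifting) assms coord_expansion sum.cong)

lemma linear_expansion:
  assumes "linear f" "v \<in> span B"
  shows "f v = (\<Sum>b\<in>B. coord b v *\<^sub>R f b)"
proof -
  have "f v = f (\<Sum>b\<in>B. coord b v *\<^sub>R b)"
    using coord_expansion[OF assms(2)] by simp
  then show ?thesis
    by (simp add: linear_sum[OF assms(1)] linear_scale[OF assms(1)])
qed

lemma cnorm_nonneg: "0 \<le> cnorm v"
  unfolding cnorm_def by (simp add: sum_nonneg)

lemma cnorm_add: "cnorm (v + w) \<le> cnorm v + cnorm w"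
  unfolding cnorm_def
  by (simp add: linear_add[OF linear_coord] sum.distrib[symmetric] sum_mono)

lemma cnorm_scaleR: "cnorm (c *\<^sub>R v) = \<bar>c\<bar> * cnorm v"
  unfolding cnorm_def
  by (simp add: linear_scale[OF linear_coord] abs_mult sum_distrib_left)

lemma cnorm_zero: "cnorm 0 = 0"
  using cnorm_scaleR[of 0 0] by simp

lemma cnorm_sum: "cnorm (\<Sum>i\<in>I. f i) \<le> (\<Sum>i\<in>I. cnorm (f i))"
proof (induction I rule: infinite_finite_induct)
  case (insert i I)
  then show ?case
    using cnorm_add[of "f i" "\<Sum>j\<in>I. f j"] by simp
qed (simp_all add: cnorm_zero)

lemma coord_le_cnorm: "b \<in> B \<Longrightarrow> \<bar>coord b v\<bar> \<le> cnorm v"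
  unfolding cnorm_def using finite_B by (intro member_le_sum) auto

text \<open>Continuity of linear functionals comes for free in finite dimension. The constant
  depends on \<open>L\<close>, so for evaluation at a point it depends on the point.\<close>

lemma functional_bound:
  fixes L :: "'a \<Rightarrow> real"
  assumes "linear L" "v \<in> span B"
  shows "\<bar>L v\<bar> \<le> (\<Sum>b\<in>B. \<bar>L b\<bar>) * cnorm v"
proof -
  have "\<bar>L v\<bar> \<le> (\<Sum>b\<in>B. \<bar>coord b v * L b\<bar>)"
    using linear_expansion[OF assms] by (simp add: sum_abs)
  also have "\<dots> \<le> (\<Sum>b\<in>B. cnorm v * \<bar>L b\<bar>)"
    by (intro sum_mono) (simp add: abs_mult mult_right_mono coord_le_cnorm)
  finally show ?thesis
    by (simp add: sum_distrib_left mult.commute)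
qed

lemma cnorm_eq_0: "v \<in> span B \<Longrightarrow> cnorm v = 0 \<Longrightarrow> v = 0"
  by (rule span_eqI)
     (use coord_le_cnorm[of _ v] in \<open>auto simp: span_zero linear_0[OF linear_coord]\<close>)

lemma surj_on_span_if_inj_on:
  assumes "linear f" "f ` span B \<subseteq> span B" "inj_on f (span B)"
  shows "f ` span B = span B"
proof -
  have "independent (f ` B)"
    by (rule linear_independent_injective_image[OF assms(1) independent_B assms(3)])
  moreover have "f ` B \<subseteq> span B"
    using assms(2) by (meson image_mono order_trans span_superset)
  ultimately have image: "independent (f ` B)" "f ` B \<subseteq> span B" .
  have card: "card (f ` B) = card B"
    by (intro card_image inj_on_subset[OF assms(3)] span_superset)
  have "y \<in> f ` span B" if y: "y \<in> span B" for y
  proof (rule ccontr)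
    assume "y \<notin> f ` span B"
    then have y': "y \<notin> span (f ` B)"
      by (simp add: linear_span_image[OF assms(1)])
    then have "independent (insert y (f ` B))"
      using image(1) by (simp add: independent_insertI)
    then have "card (insert y (f ` B)) \<le> card B"
      using independent_span_bound[OF finite_B] image(2) y by blast
    moreover have "y \<notin> f ` B"
      using y' span_base[of y "f ` B"] by argo
    ultimately show False
      using card finite_B by simp
  qed
  with assms(2) show ?thesis by auto
qed

end

section \<open>Operator bound and resolvent on an invariant span\<close>

locale finite_flow = finite_basis B for B :: "'a::real_vector set" +
  fixes A :: "'a \<Rightarrow> 'a"
  assumes linear_A: "linear A"
    and invariant: "A ` span B \<subseteq> span B"
begin

text \<open>An upper bound for the operator norm of \<open>A\<close> with respect to the l1 norm. A
  maximum over \<open>B\<close> would be sharp, but the sum also makes sense for empty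
  \<open>B\<close>.\<close>

definition bound :: real where
  "bound = (\<Sum>b\<in>B. cnorm (A b))"

lemma bound_nonneg: "0 \<le> bound"
  unfolding bound_def by (simp add: sum_nonneg cnorm_nonneg)

lemma A_in_span: "v \<in> span B \<Longrightarrow> A v \<in> span B"
  using invariant by blast

lemma cnorm_A:
  assumes "v \<in> span B"
  shows "cnorm (A v) \<le> bound * cnorm v"
proof -
  have "cnorm (A v) = cnorm (\<Sum>b\<in>B. coord b v *\<^sub>R A b)"
    using linear_expansion[OF linear_A assms] by simp
  also have "\<dots> \<le> (\<Sum>b\<in>B. \<bar>coord b v\<bar> * cnorm (A b))"
    using cnorm_sum[of "\<lambda>b. coord b v *\<^sub>R A b" B] by (simp add: cnorm_scaleR)
  also have "\<dots> \<le> (\<Sum>b\<in>B. cnorm v * cnorm (A b))"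
    by (intro sum_mono mult_right_mono coord_le_cnorm cnorm_nonneg)
  finally show ?thesis
    by (simp add: bound_def sum_distrib_left mult.commute)
qed

lemma funpow_in_span: "v \<in> span B \<Longrightarrow> (A ^^ k) v \<in> span B"
  by (induction k) (auto intro: A_in_span)

lemma cnorm_funpow: "v \<in> span B \<Longrightarrow> cnorm ((A ^^ k) v) \<le> bound ^ k * cnorm v"
proof (induction k)
  case (Suc k)
  have "cnorm ((A ^^ Suc k) v) \<le> bound * cnorm ((A ^^ k) v)"
    using cnorm_A[OF funpow_in_span[OF Suc.prems]] by simp
  also have "\<dots> \<le> bound * (bound ^ k * cnorm v)"
    by (intro mult_left_mono Suc bound_nonneg)
  finally show ?case by simp
qed simp

text \<open>A kernel vector satisfies \<open>v = l A v\<close>, so its norm is at most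
  \<open>l * bound\<close> times itself and must vanish. Injectivity then gives surjectivity by
  dimension, without a Neumann series.\<close>

lemma bij_betw_resolvent:
  assumes "0 \<le> l" "l * bound < 1"
  shows "bij_betw (\<lambda>p. p - l *\<^sub>R A p) (span B) (span B)"
proof -
  let ?f = "\<lambda>p. p - l *\<^sub>R A p"
  have lin: "linear ?f"
    by (intro linear_compose_sub linear_ident linear_compose_scale_right linear_A)
  have inv: "?f ` span B \<subseteq> span B"
    by (auto intro!: span_diff span_scale A_in_span)
  have "v = 0" if v: "v \<in> span B" "?f v = 0" for v
  proof -
    have "cnorm v = l * cnorm (A v)"
      using v(2) assms(1) cnorm_scaleR[of l "A v"] by simp
    also have "\<dots> \<le> l * bound * cnorm v"
      using mult_left_mono[OF cnorm_A[OF v(1)] assms(1)] by (simp add: mult.assoc)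
    finally have "(1 - l * bound) * cnorm v \<le> 0"
      by (simp add: algebra_simps)
    then have "cnorm v = 0"
      using assms(2) cnorm_nonneg[of v] by (simp add: mult_le_0_iff)
    then show "v = 0"
      using cnorm_eq_0 v(1) by blast
  qed
  then have "inj_on ?f (span B)"
    using linear_inj_on_iff_eq_0[OF lin subspace_span] by blast
  then show ?thesis
    using surj_on_span_if_inj_on[OF lin inv] by (simp add: bij_betw_def)
qed

section \<open>The exponential of the operator and its calculus\<close>

text \<open>The matrix exponential e^{tA} p, summed in each coordinate: only real series occur, so
  \<open>'a\<close> needs no topology.\<close>

definition flow :: "real \<Rightarrow> 'a \<Rightarrow> 'a" where
  "flow t p = (\<Sum>b\<in>B. suminf (\<lambda>k. t ^ k / fact k * coord b ((A ^^ k) p)) *\<^sub>R b)"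

lemma flow_in_span: "flow t p \<in> span B"
  unfolding flow_def by (intro span_sum span_scale span_base)

text \<open>The majorants are multiples of the terms of an exponential series. The constant
  \<open>c\<close> is left free so that coordinates can use \<open>c = 1\<close> and other
  functionals the constant of \<open>functional_bound\<close>.\<close>

lemma functional_term_bound:
  fixes L :: "'a \<Rightarrow> real"
  assumes "p \<in> span B" "\<And>v. v \<in> span B \<Longrightarrow> \<bar>L v\<bar> \<le> c * cnorm v" "0 \<le> c"
  shows "\<bar>t ^ k / fact k * L ((A ^^ k) p)\<bar> \<le> c * cnorm p * ((\<bar>t\<bar> * bound) ^ k /\<^sub>R fact k)"
proof -
  have "\<bar>L ((A ^^ k) p)\<bar> \<le> c * (bound ^ k * cnorm p)"
    using assms(2)[OF funpow_in_span[OF assms(1), of k]] cnorm_funpow[OF assms(1), of k] assms(3)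
    by (meson mult_left_mono order_trans)
  then have "\<bar>t\<bar> ^ k / fact k * \<bar>L ((A ^^ k) p)\<bar> \<le> \<bar>t\<bar> ^ k / fact k * (c * (bound ^ k * cnorm p))"
    by (rule mult_left_mono) simp
  then show ?thesis
    by (simp add: abs_mult power_abs power_mult_distrib field_simps)
qed

text \<open>The finite sum over \<open>B\<close> may be exchanged with the series, which frees the
  definition of \<open>flow\<close> from coordinates. The identities for \<open>flow\<close> below
  follow from this by a choice of \<open>L\<close> and uniqueness of sums.\<close>

lemma flow_sums:
  fixes L :: "'a \<Rightarrow> real"
  assumes "p \<in> span B" "linear L"
  shows "(\<lambda>k. t ^ k / fact k * L ((A ^^ k) p)) sums L (flow t p)"
proof -
  have "summable (\<lambda>k. t ^ k / fact k * coord b ((A ^^ k) p))" if "b \<in> B" for b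
  proof (rule summable_comparison_test'[where N = 0])
    show "summable (\<lambda>k. 1 * cnorm p * ((\<bar>t\<bar> * bound) ^ k /\<^sub>R fact k))"
      by (intro summable_mult summable_exp_generic)
    show "norm (t ^ k / fact k * coord b ((A ^^ k) p))
        \<le> 1 * cnorm p * ((\<bar>t\<bar> * bound) ^ k /\<^sub>R fact k)" for k
      unfolding real_norm_def
      by (rule functional_term_bound) (use assms coord_le_cnorm that in auto)
  qed
  then have "(\<lambda>k. \<Sum>b\<in>B. t ^ k / fact k * coord b ((A ^^ k) p) * L b) sums
      (\<Sum>b\<in>B. suminf (\<lambda>k. t ^ k / fact k * coord b ((A ^^ k) p)) * L b)"
    by (intro sums_sum sums_mult2 summable_sums)
  moreover have "(\<Sum>b\<in>B. t ^ k / fact k * coord b ((A ^^ k) p) * L b)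
      = t ^ k / fact k * L ((A ^^ k) p)" for k
    using linear_expansion[OF assms(2) funpow_in_span[OF assms(1), of k]]
    by (simp add: sum_distrib_left mult.assoc)
  moreover have "(\<Sum>b\<in>B. suminf (\<lambda>k. t ^ k / fact k * coord b ((A ^^ k) p)) * L b) = L (flow t p)"
    by (simp add: flow_def linear_sum[OF assms(2)] linear_scale[OF assms(2)])
  ultimately show ?thesis by simp
qed

lemma functional_flow_bound:
  fixes L :: "'a \<Rightarrow> real"
  assumes "p \<in> span B" "linear L" "\<And>v. v \<in> span B \<Longrightarrow> \<bar>L v\<bar> \<le> c * cnorm v" "0 \<le> c"
  shows "\<bar>L (flow t p)\<bar> \<le> c * cnorm p * exp (\<bar>t\<bar> * bound)"
proof -
  have "norm (suminf (\<lambda>k. t ^ k / fact k * L ((A ^^ k) p)))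
      \<le> suminf (\<lambda>k. c * cnorm p * ((\<bar>t\<bar> * bound) ^ k /\<^sub>R fact k))"
  proof (rule norm_suminf_le)
    show "summable (\<lambda>k. c * cnorm p * ((\<bar>t\<bar> * bound) ^ k /\<^sub>R fact k))"
      by (intro summable_mult summable_exp_generic)
    show "norm (t ^ k / fact k * L ((A ^^ k) p))
        \<le> c * cnorm p * ((\<bar>t\<bar> * bound) ^ k /\<^sub>R fact k)" for k
      unfolding real_norm_def by (rule functional_term_bound) (use assms in auto)
  qed
  moreover have "suminf (\<lambda>k. t ^ k / fact k * L ((A ^^ k) p)) = L (flow t p)"
    using flow_sums[OF assms(1,2)] by (rule sums_unique[symmetric])
  moreover have "suminf (\<lambda>k. c * cnorm p * ((\<bar>t\<bar> * bound) ^ k /\<^sub>R fact k))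
      = c * cnorm p * exp (\<bar>t\<bar> * bound)"
    using suminf_mult[OF summable_exp_generic[of "\<bar>t\<bar> * bound"]] by (simp add: exp_def)
  ultimately show ?thesis by simp
qed

lemma functional_flow_0:
  fixes L :: "'a \<Rightarrow> real"
  assumes "p \<in> span B" "linear L"
  shows "L (flow 0 p) = L p"
proof -
  \<comment> \<open>Since \<open>0 ^ 0 = 1\<close>, exactly the term \<open>k = 0\<close>
    survives.\<close>
  have "(\<lambda>k. 0 ^ k / fact k * L ((A ^^ k) p)) = (\<lambda>k. if k = 0 then L p else 0)"
    by (auto simp: fun_eq_iff)
  then show ?thesis
    using flow_sums[OF assms, of 0] sums_single[of 0 "\<lambda>_. L p"] by (simp add: sums_unique2)
qed

lemma flow_0: "p \<in> span B \<Longrightarrow> flow 0 p = p"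
  by (rule span_eqI) (auto simp: flow_in_span functional_flow_0 linear_coord)

text \<open>The functional \<open>coord b \<circ> A\<close> on the series of \<open>p\<close> and
  \<open>coord b\<close> on the series of \<open>A p\<close> have the same terms, because
  \<open>A\<close> commutes with its powers.\<close>

lemma flow_A:
  assumes "p \<in> span B"
  shows "flow t (A p) = A (flow t p)"
proof (rule span_eqI)
  fix b assume "b \<in> B"
  have "(\<lambda>k. t ^ k / fact k * (coord b \<circ> A) ((A ^^ k) p)) sums (coord b \<circ> A) (flow t p)"
    by (intro flow_sums assms linear_compose linear_A linear_coord)
  then have "(\<lambda>k. t ^ k / fact k * coord b ((A ^^ k) (A p))) sums coord b (A (flow t p))"
    by (simp add: funpow_swap1)
  then show "coord b (flow t (A p)) = coord b (A (flow t p))"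
    using flow_sums[OF A_in_span[OF assms] linear_coord] sums_unique2 by blast
qed (intro flow_in_span A_in_span)+

text \<open>Linearity of the flow in the one combination that appears when e^{-s} e^{slA} q is
  differentiated in s.\<close>

lemma functional_flow_resolvent:
  fixes L :: "'a \<Rightarrow> real"
  assumes "q \<in> span B" "linear L"
  shows "L (flow t (q - l *\<^sub>R A q)) = L (flow t q) - l * L (flow t (A q))"
proof -
  have lin: "linear (A ^^ k)" for k
  proof (induction k)
    case (Suc k)
    show ?case using linear_compose[OF Suc linear_A] by (simp add: o_def)
  qed (simp add: linear_ident id_def)
  have "(\<lambda>k. t ^ k / fact k * L ((A ^^ k) q) - l * (t ^ k / fact k * L ((A ^^ k) (A q))))
      sums (L (flow t q) - l * L (flow t (A q)))"
    by (intro sums_diff sums_mult flow_sums assms A_in_span)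
  moreover have "t ^ k / fact k * L ((A ^^ k) q) - l * (t ^ k / fact k * L ((A ^^ k) (A q)))
      = t ^ k / fact k * L ((A ^^ k) (q - l *\<^sub>R A q))" for k
    by (simp add: linear_diff[OF lin] linear_scale[OF lin] linear_diff[OF assms(2)]
        linear_scale[OF assms(2)] algebra_simps)
  ultimately have "(\<lambda>k. t ^ k / fact k * L ((A ^^ k) (q - l *\<^sub>R A q)))
      sums (L (flow t q) - l * L (flow t (A q)))"
    by simp
  moreover have "q - l *\<^sub>R A q \<in> span B"
    by (intro span_diff span_scale A_in_span assms)
  ultimately show ?thesis
    using flow_sums[OF _ assms(2)] sums_unique2 by blast
qed

text \<open>Termwise differentiation of an everywhere convergent power series: \<open>diffs\<close>
  turns L(A^k p)/k! into L(A^k (A p))/k!, the coefficients belonging to \<open>A p\<close>.\<close>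

lemma functional_flow_deriv:
  fixes L :: "'a \<Rightarrow> real"
  assumes "p \<in> span B" "linear L"
  shows "((\<lambda>t. L (flow t p)) has_real_derivative L (flow t (A p))) (at t)"
proof -
  define c where "c k = L ((A ^^ k) p) / fact k" for k
  have sums: "(\<lambda>k. c k * y ^ k) sums L (flow y p)" for y
    using flow_sums[OF assms, of y] by (simp add: c_def field_simps)
  have "diffs c k = L ((A ^^ k) (A p)) / fact k" for k
    by (simp add: diffs_def c_def funpow_swap1 field_simps del: of_nat_Suc)
  then have "diffs c k * t ^ k = t ^ k / fact k * L ((A ^^ k) (A p))" for k
    by simp
  then have "(\<lambda>k. diffs c k * t ^ k) sums L (flow t (A p))"
    using flow_sums[OF A_in_span[OF assms(1)] assms(2), of t] by simp
  then have "suminf (\<lambda>k. diffs c k * t ^ k) = L (flow t (A p))"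
    by (rule sums_unique[symmetric])
  moreover have "(\<lambda>y. suminf (\<lambda>k. c k * y ^ k)) = (\<lambda>y. L (flow y p))"
    using sums by (auto simp: sums_iff)
  ultimately show ?thesis
    using termdiffs_strong_converges_everywhere[of c t] sums by (auto simp: sums_iff)
qed

section \<open>From a positive flow to a positive resolvent\<close>

text \<open>Behind this stands the Laplace formula for the resolvent, q = integral over s \<ge> 0 of
  e^{-s} e^{slA} (q - l A q). The integral is replaced by monotonicity of its antiderivative:
  \<open>g\<close> falls from \<open>L q\<close> at 0 to the limit 0.\<close>

lemma functional_nonneg_if_flow_nonneg:
  fixes L :: "'a \<Rightarrow> real"
  assumes "q \<in> span B" "linear L" "0 \<le> l" "l * bound < 1"
    and nonneg: "\<And>t. 0 \<le> t \<Longrightarrow> 0 \<le> L (flow t (q - l *\<^sub>R A q))"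
  shows "0 \<le> L q"
proof -
  define g where "g s = exp (- s) * L (flow (l * s) q)" for s
  define c where "c = (\<Sum>b\<in>B. \<bar>L b\<bar>)"
  have deriv: "(g has_real_derivative - (exp (- s) * L (flow (l * s) (q - l *\<^sub>R A q)))) (at s)"
    for s
  proof -
    have "((\<lambda>s. L (flow (l * s) q)) has_real_derivative L (flow (l * s) (A q)) * l) (at s)"
      by (rule DERIV_chain2[OF functional_flow_deriv[OF assms(1,2)]])
         (auto intro!: derivative_eq_intros)
    then have "(g has_real_derivative
        - exp (- s) * L (flow (l * s) q) + L (flow (l * s) (A q)) * l * exp (- s)) (at s)"
      unfolding g_def by (auto intro!: derivative_eq_intros)
    then show ?thesis
      by (simp add: functional_flow_resolvent[OF assms(1,2)] algebra_simps)
  qed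
  have le: "g s \<le> L q" if "0 \<le> s" for s
  proof -
    have "g s \<le> g 0"
    proof (rule DERIV_nonpos_imp_nonincreasing[OF that])
      fix x assume "0 \<le> x" "x \<le> s"
      then have "0 \<le> exp (- x) * L (flow (l * x) (q - l *\<^sub>R A q))"
        using assms(3) by (intro mult_nonneg_nonneg nonneg) auto
      then show "\<exists>y. (g has_real_derivative y) (at x) \<and> y \<le> 0"
        using deriv[of x] by fastforce
    qed
    then show ?thesis
      by (simp add: g_def functional_flow_0[OF assms(1,2)])
  qed
  have "\<bar>g s\<bar> \<le> c * cnorm q * exp (- (1 - l * bound) * s)" if "0 \<le> s" for s
  proof -
    have "\<bar>L (flow (l * s) q)\<bar> \<le> c * cnorm q * exp (\<bar>l * s\<bar> * bound)"
      by (rule functional_flow_bound[OF assms(1,2)])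
         (auto simp: c_def sum_nonneg intro: functional_bound assms(2))
    then have "\<bar>g s\<bar> \<le> exp (- s) * (c * cnorm q * exp (\<bar>l * s\<bar> * bound))"
      unfolding g_def abs_mult by simp
    also have "\<dots> = c * cnorm q * (exp (- s) * exp (l * s * bound))"
      using that assms(3) by simp
    also have "exp (- s) * exp (l * s * bound) = exp (- (1 - l * bound) * s)"
      by (simp add: exp_add[symmetric] algebra_simps)
    finally show ?thesis .
  qed
  then have *: "\<forall>\<^sub>F s in at_top. norm (g s) \<le> c * cnorm q * exp (- (1 - l * bound) * s)"
    unfolding real_norm_def using eventually_ge_at_top[of 0] by (rule eventually_mono[rotated])
  \<comment> \<open>The growth rate \<open>l * bound\<close> of the flow is below 1 and so loses
    against \<open>exp (- s)\<close>.\<close>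
  have "filterlim (\<lambda>s. - (1 - l * bound) * s) at_bot at_top"
    using assms(4)
    by (intro filterlim_tendsto_neg_mult_at_bot[OF tendsto_const] filterlim_ident) auto
  then have "((\<lambda>s. c * cnorm q * exp (- (1 - l * bound) * s)) \<longlongrightarrow> c * cnorm q * 0) at_top"
    by (intro tendsto_intros filterlim_compose[OF exp_at_bot])
  then have "(g \<longlongrightarrow> 0) at_top"
    using Lim_null_comparison[OF *] by simp
  moreover have "\<forall>\<^sub>F s in at_top. g s \<le> L q"
    using eventually_ge_at_top[of 0] by (rule eventually_mono) (rule le)
  ultimately show ?thesis
    by (rule tendsto_upperbound) simp
qed

section \<open>Convergence of the implicit Euler scheme\<close>

text \<open>Consistency of the scheme. In each coordinate the second derivative of the flow is the
  flow of \<open>A (A p)\<close>, bounded uniformly up to time \<open>T\<close>; summing over the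
  coordinates gives the factor \<open>card B\<close>.\<close>

lemma euler_defect_bound:
  assumes "p \<in> span B" "0 \<le> h" "0 \<le> s" "s + h \<le> T"
  shows "cnorm (flow (s + h) p - h *\<^sub>R A (flow (s + h) p) - flow s p)
    \<le> real (card B) * (cnorm (A (A p)) * exp (T * bound) * h\<^sup>2)"
proof -
  have "\<bar>coord b (flow (s + h) p - h *\<^sub>R A (flow (s + h) p) - flow s p)\<bar>
      \<le> cnorm (A (A p)) * exp (T * bound) * h\<^sup>2" if b: "b \<in> B" for b
  proof -
    have "\<bar>coord b (flow (s + h) p) - h * coord b (flow (s + h) (A p)) - coord b (flow s p)\<bar>
        \<le> cnorm (A (A p)) * exp (T * bound) * h\<^sup>2"
    proof (rule taylor_backward)
      fix x assume x: "s \<le> x" "x \<le> s + h"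
      have "\<bar>coord b (flow x (A (A p)))\<bar> \<le> 1 * cnorm (A (A p)) * exp (\<bar>x\<bar> * bound)"
        by (rule functional_flow_bound)
           (auto simp: assms A_in_span linear_coord coord_le_cnorm b)
      also have "\<dots> \<le> 1 * cnorm (A (A p)) * exp (T * bound)"
        using x assms cnorm_nonneg bound_nonneg
        by (intro mult_left_mono) (auto intro: mult_right_mono)
      finally show "\<bar>coord b (flow x (A (A p)))\<bar> \<le> cnorm (A (A p)) * exp (T * bound)"
        by simp
    qed (intro functional_flow_deriv assms A_in_span linear_coord)+
    then show ?thesis
      by (simp add: linear_diff[OF linear_coord] linear_scale[OF linear_coord] flow_A assms(1))
  qed
  then show ?thesis
    unfolding cnorm_def[of "_ - _"] by (rule sum_bounded_above)
qed

text \<open>Stability of the scheme. With \<open>x = h * bound\<close> the triangle inequality gives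
  the factor 1/(1 - x), which is at most \<open>1 + 2 * x\<close> on [0, 1/2]. This form is
  convenient for comparing powers with \<open>exp\<close>.\<close>

lemma cnorm_euler_step:
  assumes "v \<in> span B" "0 \<le> h" "h * bound \<le> 1 / 2"
  shows "cnorm v \<le> (1 + 2 * (h * bound)) * cnorm (v - h *\<^sub>R A v)"
proof -
  define x where "x = h * bound"
  have x: "0 \<le> x" "x \<le> 1 / 2"
    using assms bound_nonneg by (auto simp: x_def)
  have "cnorm v \<le> cnorm (v - h *\<^sub>R A v) + cnorm (h *\<^sub>R A v)"
    using cnorm_add[of "v - h *\<^sub>R A v" "h *\<^sub>R A v"] by simp
  also have "cnorm (h *\<^sub>R A v) \<le> x * cnorm v"
    using mult_left_mono[OF cnorm_A[OF assms(1)] assms(2)] assms(2)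
    by (simp add: cnorm_scaleR x_def mult.assoc)
  finally have "(1 - x) * cnorm v \<le> cnorm (v - h *\<^sub>R A v)"
    by (simp add: algebra_simps)
  then have "(1 + 2 * x) * ((1 - x) * cnorm v) \<le> (1 + 2 * x) * cnorm (v - h *\<^sub>R A v)"
    using x by (intro mult_left_mono) auto
  \<comment> \<open>The product equals \<open>1 + x * (1 - 2 * x)\<close>.\<close>
  moreover have "1 \<le> (1 + 2 * x) * (1 - x)"
    using mult_nonneg_nonneg[of x "1 - 2 * x"] x by (simp add: algebra_simps)
  then have "1 * cnorm v \<le> (1 + 2 * x) * (1 - x) * cnorm v"
    by (rule mult_right_mono) (rule cnorm_nonneg)
  ultimately show ?thesis
    by (simp add: x_def mult.assoc)
qed

text \<open>Up to step \<open>j\<close> there are \<open>j\<close> local defects, each amplified at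
  most \<open>j\<close> times by the stability factor. The common horizon \<open>T\<close> allows
  one defect bound for all steps.\<close>

lemma euler_error:
  assumes "p \<in> span B" "0 \<le> h" "h * bound \<le> 1 / 2"
    and "u 0 = p" "\<And>j. u j \<in> span B" "\<And>j. u (Suc j) - h *\<^sub>R A (u (Suc j)) = u j"
    and "real j * h \<le> T"
  shows "cnorm (flow (real j * h) p - u j)
    \<le> (1 + 2 * (h * bound)) ^ j * (real j *
        (real (card B) * (cnorm (A (A p)) * exp (T * bound) * h\<^sup>2)))"
  using assms(7)
proof (induction j)
  case 0
  then show ?case by (simp add: flow_0 assms cnorm_zero)
next
  case (Suc j)
  define \<rho> where "\<rho> = 1 + 2 * (h * bound)"
  define \<delta> where "\<delta> = real (card B) * (cnorm (A (A p)) * exp (T * bound) * h\<^sup>2)"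
  define e where "e = flow (real j * h) p - u j"
  define d where "d = flow (real j * h + h) p - h *\<^sub>R A (flow (real j * h + h) p)
    - flow (real j * h) p"
  define v where "v = flow (real (Suc j) * h) p - u (Suc j)"
  have \<rho>: "1 \<le> \<rho>"
    using assms(2) bound_nonneg by (simp add: \<rho>_def)
  have \<delta>: "0 \<le> \<delta>"
    by (auto simp: \<delta>_def intro!: mult_nonneg_nonneg cnorm_nonneg)
  have s: "real (Suc j) * h = real j * h + h"
    by (simp add: algebra_simps)
  have e: "cnorm e \<le> \<rho> ^ j * (real j * \<delta>)"
    unfolding e_def \<rho>_def \<delta>_def using Suc.prems[unfolded s] assms(2) by (intro Suc.IH) linarith
  have d: "cnorm d \<le> \<delta>"
    unfolding d_def \<delta>_def using Suc.prems[unfolded s] assms by (intro euler_defect_bound) auto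
  \<comment> \<open>Error equation: the new error solves an implicit step whose right-hand side is
    the old error plus the local defect.\<close>
  have "v - h *\<^sub>R A v = e + d"
    using assms(6)[of j]
    by (simp add: v_def e_def d_def s linear_diff[OF linear_A] scaleR_diff_right algebra_simps)
  then have "cnorm v \<le> \<rho> * cnorm (e + d)"
    using cnorm_euler_step[of v h] assms flow_in_span by (simp add: \<rho>_def v_def span_diff)
  also have "\<dots> \<le> \<rho> * (\<rho> ^ j * (real j * \<delta>) + \<rho> ^ j * \<delta>)"
  proof (intro mult_left_mono)
    \<comment> \<open>Inflating the newest defect by \<rho>^j as well lets it join the
      \<open>j\<close> earlier ones.\<close>
    have "\<delta> \<le> \<rho> ^ j * \<delta>"
      using mult_right_mono[OF one_le_power[OF \<rho>] \<delta>] by simp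
    then show "cnorm (e + d) \<le> \<rho> ^ j * (real j * \<delta>) + \<rho> ^ j * \<delta>"
      using cnorm_add[of e d] e d by linarith
  qed (use \<rho> in simp)
  also have "\<dots> = \<rho> ^ Suc j * (real (Suc j) * \<delta>)"
    by (simp add: algebra_simps)
  finally show ?case
    unfolding v_def \<rho>_def \<delta>_def .
qed

text \<open>All iterates of \<open>R (t / k)\<close> stay in \<open>P\<close>, where
  \<open>L\<close> is nonnegative, and the k-th one differs from \<open>flow t p\<close> by O(1/k),
  since \<open>k\<close> defects of order (t/k)^2 accumulate.\<close>

lemma functional_flow_nonneg_if_resolvent:
  fixes L :: "'a \<Rightarrow> real"
  assumes "p \<in> P" "P \<subseteq> span B" "linear L" "\<And>q. q \<in> P \<Longrightarrow> 0 \<le> L q" "0 \<le> t" "0 < \<epsilon>"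
    and R: "\<And>l q. 0 \<le> l \<Longrightarrow> l < \<epsilon> \<Longrightarrow> q \<in> P \<Longrightarrow> R l q \<in> P \<and> R l q - l *\<^sub>R A (R l q) = q"
  shows "0 \<le> L (flow t p)"
proof -
  define c where "c = (\<Sum>b\<in>B. \<bar>L b\<bar>)"
  \<comment> \<open>\<open>D / k\<close> will bound the error seen by \<open>L\<close>: the
    exponential dominates the amplification \<open>(1 + 2 * (h * bound)) ^ k\<close> for every
    \<open>k\<close>, and \<open>k * h^2 = t^2 / k\<close>.\<close>
  define D where
    "D = c * (exp (2 * (t * bound)) * (real (card B) * (cnorm (A (A p)) * exp (t * bound) * t\<^sup>2)))"
  have p: "p \<in> span B" using assms by blast
  have c: "0 \<le> c" by (simp add: c_def sum_nonneg)
  have step_small: "(\<lambda>k. t * inverse (real k)) \<longlonglongrightarrow> 0"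
    using tendsto_mult_left[OF lim_inverse_n, of t] by simp
  moreover have "(\<lambda>k. t * inverse (real k) * bound) \<longlonglongrightarrow> 0"
    using tendsto_mult_right[OF step_small, of bound] by simp
  \<comment> \<open>Three demands on \<open>k\<close>: the step lies in the range of
    \<open>R\<close>, it is small enough for stability, and \<open>k\<close> is positive because
    \<open>inverse 0 = 0\<close> would break \<open>real k * h = t\<close>.\<close>
  ultimately have "\<forall>\<^sub>F k in sequentially. t * inverse (real k) < \<epsilon> \<and>
      t * inverse (real k) * bound < 1 / 2 \<and> 0 < k"
    using assms(6)
    by (intro eventually_conj order_tendstoD(2)[where a = "1 / 2"] order_tendstoD(2)[where a = \<epsilon>]
        eventually_gt_at_top) auto
  then have ev: "\<forall>\<^sub>F k in sequentially. - (D * inverse (real k)) \<le> L (flow t p)"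
  proof (rule eventually_mono, elim conjE)
    fix k :: nat
    define h where "h = t * inverse (real k)"
    assume "t * inverse (real k) < \<epsilon>" "t * inverse (real k) * bound < 1 / 2" and k: "0 < k"
    then have h: "0 \<le> h" "h < \<epsilon>" "h * bound \<le> 1 / 2" "real k * h = t"
      using assms(5) by (auto simp: h_def)
    define u where "u j = (R h ^^ j) p" for j
    have u_P: "u j \<in> P" for j
      by (induction j) (use assms(1) R h in \<open>auto simp: u_def\<close>)
    then have u_span: "u j \<in> span B" for j
      using assms(2) by blast
    have "cnorm (flow (real k * h) p - u k) \<le> (1 + 2 * (h * bound)) ^ k * (real k *
        (real (card B) * (cnorm (A (A p)) * exp (t * bound) * h\<^sup>2)))"
    proof (rule euler_error)
      show "u (Suc j) - h *\<^sub>R A (u (Suc j)) = u j" for j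
        using R[OF h(1,2) u_P[of j]] by (simp add: u_def)
    qed (use p h u_span in \<open>auto simp: u_def\<close>)
    also have "\<dots> \<le> exp (2 * (t * bound)) * (real k *
        (real (card B) * (cnorm (A (A p)) * exp (t * bound) * h\<^sup>2)))"
    proof (rule mult_right_mono)
      have "(1 + 2 * (h * bound)) ^ k \<le> exp (2 * (h * bound)) ^ k"
        using h bound_nonneg by (intro power_mono exp_ge_add_one_self) auto
      also have "\<dots> = exp (2 * (t * bound))"
        by (simp add: exp_of_nat_mult[symmetric] h(4)[symmetric] ac_simps)
      finally show "(1 + 2 * (h * bound)) ^ k \<le> exp (2 * (t * bound))" .
    qed (auto intro!: mult_nonneg_nonneg cnorm_nonneg)
    finally have "c * cnorm (flow t p - u k) \<le> c * (exp (2 * (t * bound)) * (real k *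
        (real (card B) * (cnorm (A (A p)) * exp (t * bound) * h\<^sup>2))))"
      using c h(4) by (simp add: mult_left_mono)
    also have "\<dots> = D * inverse (real k)"
      using k by (simp add: D_def h_def power2_eq_square field_simps)
    finally have "\<bar>L (flow t p - u k)\<bar> \<le> D * inverse (real k)"
      using functional_bound[OF assms(3), of "flow t p - u k"] flow_in_span u_span
      by (force simp: c_def span_diff)
    then show "- (D * inverse (real k)) \<le> L (flow t p)"
      using assms(4)[OF u_P[of k]] by (simp add: linear_diff[OF assms(3)])
  qed
  have "(\<lambda>k. - (D * inverse (real k))) \<longlonglongrightarrow> - (D * 0)"
    by (intro tendsto_intros lim_inverse_n)
  then show ?thesis
    using tendsto_upperbound[OF _ ev] by simp
qed

end

section \<open>Evaluation, supports and the exponential of an operator on polynomials\<close>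

lemma linear_lookup: "linear (\<lambda>p. Poly_Mapping.lookup p m)"
  by (rule linearI) (simp_all add: lookup_add scaleR_poly_mapping.rep_eq)

text \<open>Coefficients off the support vanish, so polynomials with different supports can be
  summed over one common index set.\<close>

lemma peval_superset:
  assumes "finite S" "Poly_Mapping.keys p \<subseteq> S"
  shows "peval p x = (\<Sum>m\<in>S. Poly_Mapping.lookup p m *
     (\<Prod>i\<in>UNIV. (x $ i) ^ Poly_Mapping.lookup m i))"
  unfolding peval_def using assms
  by (intro sum.mono_neutral_left) (auto simp: in_keys_iff)

lemma linear_peval: "linear (\<lambda>p. peval p x)"
proof (rule linearI)
  fix p q :: "'a rpoly"
  have "Poly_Mapping.keys (p + q) \<subseteq> Poly_Mapping.keys p \<union> Poly_Mapping.keys q"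
    by (rule keys_add)
  then show "peval (p + q) x = peval p x + peval q x"
    by (simp add: peval_superset[of "Poly_Mapping.keys p \<union> Poly_Mapping.keys q"]
        lookup_add distrib_right sum.distrib)
next
  fix c :: real and p :: "'a rpoly"
  have "Poly_Mapping.keys (c *\<^sub>R p) \<subseteq> Poly_Mapping.keys p"
    by (auto simp: in_keys_iff scaleR_poly_mapping.rep_eq)
  then show "peval (c *\<^sub>R p) x = c *\<^sub>R peval p x"
    by (simp add: peval_superset[of "Poly_Mapping.keys p"] scaleR_poly_mapping.rep_eq
        sum_distrib_left mult.assoc)
qed

lemma keys_span:
  fixes p :: "'n::finite rpoly"
  assumes "p \<in> span B"
  shows "Poly_Mapping.keys p \<subseteq> (\<Union>b\<in>B. Poly_Mapping.keys b)"
proof -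
  have "subspace {p :: 'n rpoly. Poly_Mapping.keys p \<subseteq> (\<Union>b\<in>B. Poly_Mapping.keys b)}"
    unfolding subspace_def
  proof (intro conjI ballI allI)
    fix p q :: "'n rpoly"
    assume "p \<in> {p. Poly_Mapping.keys p \<subseteq> (\<Union>b\<in>B. Poly_Mapping.keys b)}"
      "q \<in> {p. Poly_Mapping.keys p \<subseteq> (\<Union>b\<in>B. Poly_Mapping.keys b)}"
    then show "p + q \<in> {p. Poly_Mapping.keys p \<subseteq> (\<Union>b\<in>B. Poly_Mapping.keys b)}"
      using keys_add[of p q] by blast
  next
    fix c :: real and p :: "'n rpoly"
    assume "p \<in> {p. Poly_Mapping.keys p \<subseteq> (\<Union>b\<in>B. Poly_Mapping.keys b)}"
    moreover have "Poly_Mapping.keys (c *\<^sub>R p) \<subseteq> Poly_Mapping.keys p"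
      by (auto simp: in_keys_iff scaleR_poly_mapping.rep_eq)
    ultimately show "c *\<^sub>R p \<in> {p. Poly_Mapping.keys p \<subseteq> (\<Union>b\<in>B. Poly_Mapping.keys b)}"
      by blast
  qed simp
  then have "span B \<subseteq> {p. Poly_Mapping.keys p \<subseteq> (\<Union>b\<in>B. Poly_Mapping.keys b)}"
    by (intro span_minimal) auto
  then show ?thesis using assms by blast
qed

text \<open>Only the finitely many monomials of the generators can occur in the span. This supplies
  the degree bound that \<open>poly_converges\<close> demands.\<close>

lemma total_degree_span_bounded:
  fixes B :: "'n::finite rpoly set"
  assumes "finite B"
  shows "\<exists>d. \<forall>p\<in>span B. total_degree p \<le> d"
proof (intro exI ballI)
  fix p assume "p \<in> span B"
  then have "Poly_Mapping.keys p \<subseteq> (\<Union>b\<in>B. Poly_Mapping.keys b)"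
    by (rule keys_span)
  then show "total_degree p \<le> Max (insert 0 ((\<lambda>m. \<Sum>i\<in>UNIV. Poly_Mapping.lookup m i) `
      (\<Union>b\<in>B. Poly_Mapping.keys b)))"
    unfolding total_degree_def using assms by (intro Max_mono) auto
qed

text \<open>The partial sums stay in \<open>span B\<close>, which bounds their degrees, and
  \<open>flow_sums\<close> for the coefficient functionals gives coefficientwise convergence.
  Uniqueness of the limit then evaluates the \<open>THE\<close>, for every real
  \<open>t\<close>.\<close>

lemma op_exp_eq_flow:
  fixes A :: "'n::finite rpoly \<Rightarrow> 'n rpoly"
  assumes "finite_flow B A" "p \<in> span B"
  shows "op_exp t A p = finite_flow.flow B A t p"
proof -
  interpret finite_flow B A by fact
  have "exp_partial t A p N \<in> span B" for N
    unfolding exp_partial_def by (intro span_sum span_scale funpow_in_span assms(2))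
  then have "\<exists>d. \<forall>N. total_degree (exp_partial t A p N) \<le> d"
    using total_degree_span_bounded[OF finite_B] by blast
  moreover have "(\<lambda>N. Poly_Mapping.lookup (exp_partial t A p N) m)
      \<longlonglongrightarrow> Poly_Mapping.lookup (flow t p) m" for m
    using flow_sums[OF assms(2) linear_lookup[of m], of t]
    by (simp add: sums_def exp_partial_def linear_sum[OF linear_lookup]
        linear_scale[OF linear_lookup])
  ultimately have "poly_converges (exp_partial t A p) (flow t p)"
    by (simp add: poly_converges_def)
  then show ?thesis
    unfolding op_exp_def by (metis poly_converges_unique the_equality)
qed

lemma fin_dim_invariant_flow:
  assumes "fin_dim_subspace V" "linear A" "A ` V \<subseteq> V"
  obtains B where "finite_flow B A" "span B = V"
proof -
  obtain C where C: "finite C" "span C = V"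
    using assms(1) by (auto simp: fin_dim_subspace_def)
  obtain B where B: "B \<subseteq> C" "independent B" "C \<subseteq> span B"
    using maximal_independent_subset[of C] by blast
  have "span B = V"
    using B C by (metis span_mono span_minimal subspace_span subset_antisym)
  moreover have "finite_flow B A"
    by unfold_locales (use B C assms calculation in \<open>auto intro: finite_subset simp: linear_add linear_scale\<close>)
  ultimately show ?thesis
    using that by blast
qed

lemma linear_if_lie_g: "A \<in> lie_g \<Longrightarrow> linear A"
  by (simp add: lie_g_def)

section \<open>Positivity of the semi-group and of the resolvents\<close>

theorem theorem6p3:
  fixes K :: "(real ^ 'n::finite) set"
    and A :: "'n rpoly \<Rightarrow> 'n rpoly"
    and V :: "nat \<Rightarrow> 'n rpoly set"
  assumes "closed K"
    and "A \<in> lie_g"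
    and "\<And>i. fin_dim_subspace (V i)"
    and "\<And>i. A ` V i \<subseteq> V i"
    and "(\<Union>i. V i) = UNIV"
  shows "(\<forall>t\<ge>0. op_exp t A ` Pos K \<subseteq> Pos K) \<longleftrightarrow>
    (\<forall>i. \<exists>\<epsilon>>0. \<forall>l\<in>{0..<\<epsilon>}.
       bij_betw (\<lambda>p. p - l *\<^sub>R A p) (V i) (V i) \<and>
       inv_into (V i) (\<lambda>p. p - l *\<^sub>R A p) ` (Pos K \<inter> V i) \<subseteq> Pos K \<inter> V i)"
    (is "?semigroup \<longleftrightarrow> ?resolvent")
proof
  assume semigroup: ?semigroup
  show ?resolvent
  proof
    fix i
    obtain B where flow: "finite_flow B A" and V: "span B = V i"
      using fin_dim_invariant_flow[OF assms(3) linear_if_lie_g[OF assms(2)] assms(4)] by blast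
    interpret finite_flow B A by fact
    show "\<exists>\<epsilon>>0. \<forall>l\<in>{0..<\<epsilon>}. bij_betw (\<lambda>p. p - l *\<^sub>R A p) (V i) (V i) \<and>
       inv_into (V i) (\<lambda>p. p - l *\<^sub>R A p) ` (Pos K \<inter> V i) \<subseteq> Pos K \<inter> V i"
    proof (intro exI conjI ballI)
      \<comment> \<open>The summand 1 keeps the threshold positive when \<open>bound = 0\<close>,
        and \<open>l\<close> below it still satisfies \<open>l * bound < 1\<close>.\<close>
      show "0 < 1 / (bound + 1)"
        using bound_nonneg by simp
      fix l assume "l \<in> {0..<1 / (bound + 1)}"
      then have "0 \<le> l" "l * (bound + 1) < 1"
        using bound_nonneg by (auto simp: field_simps)
      then have l: "0 \<le> l" "l * bound < 1"
        by (auto simp: distrib_left)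
      show bij: "bij_betw (\<lambda>p. p - l *\<^sub>R A p) (V i) (V i)"
        using bij_betw_resolvent[OF l] V by simp
      show "inv_into (V i) (\<lambda>p. p - l *\<^sub>R A p) ` (Pos K \<inter> V i) \<subseteq> Pos K \<inter> V i"
      proof (rule image_subsetI)
        fix p assume p: "p \<in> Pos K \<inter> V i"
        define q where "q = inv_into (V i) (\<lambda>p. p - l *\<^sub>R A p) p"
        \<comment> \<open>\<open>inv_into\<close> is a genuine inverse only on the image, so
          membership of \<open>p\<close> there comes first.\<close>
        have p_image: "p \<in> (\<lambda>p. p - l *\<^sub>R A p) ` V i"
          using bij p by (simp add: bij_betw_def)
        have q: "q \<in> span B" "q - l *\<^sub>R A q = p"
          using inv_into_into[OF p_image] f_inv_into_f[OF p_image] V by (simp_all add: q_def)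
        \<comment> \<open>The functional is evaluation at \<open>x\<close>; since
          \<open>q - l A q = p\<close>, the flow to be controlled is e^{tA} p.\<close>
        have "0 \<le> peval q x" if "x \<in> K" for x
        proof (rule functional_nonneg_if_flow_nonneg[OF q(1) linear_peval l])
          fix t :: real assume "0 \<le> t"
          then have "op_exp t A p \<in> Pos K"
            using semigroup p by blast
          then show "0 \<le> peval (flow t (q - l *\<^sub>R A q)) x"
            using op_exp_eq_flow[OF flow] p V q(2) that by (simp add: Pos_def)
        qed
        then show "inv_into (V i) (\<lambda>p. p - l *\<^sub>R A p) p \<in> Pos K \<inter> V i"
          using q(1) V by (simp add: q_def Pos_def)
      qed
    qed
  qed
next
  assume resolvent: ?resolvent
  show ?semigroup
  proof (intro allI impI image_subsetI)
    fix t :: real and p assume t: "0 \<le> t" and p: "p \<in> Pos K"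
    \<comment> \<open>Once \<open>p\<close> lies in \<open>V i\<close>, the whole argument stays
      there and a single \<epsilon> is enough.\<close>
    obtain i where i: "p \<in> V i"
      using assms(5) by blast
    obtain B where flow: "finite_flow B A" and V: "span B = V i"
      using fin_dim_invariant_flow[OF assms(3) linear_if_lie_g[OF assms(2)] assms(4)] by blast
    interpret finite_flow B A by fact
    obtain \<epsilon> where "\<epsilon> > 0" and "\<forall>l\<in>{0..<\<epsilon>}.
       bij_betw (\<lambda>p. p - l *\<^sub>R A p) (V i) (V i) \<and>
       inv_into (V i) (\<lambda>p. p - l *\<^sub>R A p) ` (Pos K \<inter> V i) \<subseteq> Pos K \<inter> V i"
      using spec[OF resolvent, of i] by (elim exE conjE)
    then have \<epsilon>: "bij_betw (\<lambda>p. p - l *\<^sub>R A p) (V i) (V i) \<and>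
       inv_into (V i) (\<lambda>p. p - l *\<^sub>R A p) ` (Pos K \<inter> V i) \<subseteq> Pos K \<inter> V i"
      if "0 \<le> l" "l < \<epsilon>" for l
      using that by simp
    \<comment> \<open>The Euler limit is taken at each \<open>x\<close> separately, so its error
      constant may depend on \<open>x\<close> and no uniformity over \<open>K\<close> is required.
      The invariant set is \<open>Pos K \<inter> V i\<close>.\<close>
    have "0 \<le> peval (flow t p) x" if "x \<in> K" for x
    proof (rule functional_flow_nonneg_if_resolvent[OF _ _ linear_peval])
      show "p \<in> Pos K \<inter> V i" "Pos K \<inter> V i \<subseteq> span B"
        using p i V by auto
      show "0 \<le> peval q x" if "q \<in> Pos K \<inter> V i" for q
        using that \<open>x \<in> K\<close> by (simp add: Pos_def)
      fix l q assume l: "0 \<le> l" "l < \<epsilon>" and q: "q \<in> Pos K \<inter> V i"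
      let ?R = "\<lambda>l. inv_into (V i) (\<lambda>p. p - l *\<^sub>R A p)"
      have "q \<in> (\<lambda>p. p - l *\<^sub>R A p) ` V i"
        using \<epsilon>[OF l] q by (simp add: bij_betw_def)
      then have "?R l q - l *\<^sub>R A (?R l q) = q"
        by (rule f_inv_into_f)
      then show "?R l q \<in> Pos K \<inter> V i \<and> ?R l q - l *\<^sub>R A (?R l q) = q"
        using \<epsilon>[OF l] q by blast
    qed (use t \<open>\<epsilon> > 0\<close> in auto)
    then show "op_exp t A p \<in> Pos K"
      using op_exp_eq_flow[OF flow] i V by (simp add: Pos_def)
  qed
qed

end
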